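(* Let $\mathbf{U}=(\rho,\rho\mathbf{u},p_\parallel,e,\mathbf{B})^\top$ be a smooth solution, depending on $(x,t)$ only, of the CGL system $$\partial_t\rho+\nabla\cdot(\rho\mathbf{u})=0,$$ $$\partial_t(\rho\mathbf{u})+\nabla\cdot\Big[\rho\mathbf{u}\mathbf{u}+p_\perp\mathbf{I}+(p_\parallel-p_\perp)\mathbf{b}\mathbf{b}-\big(\mathbf{B}\mathbf{B}-\tfrac{|\mathbf{B}|^2}{2}\mathbf{I}\big)\Big]=0,$$ $$\partial_t p_\parallel+\nabla\cdot(p_\parallel\mathbf{u})=-2p_\parallel\,\mathbf{b}\cdot\nabla\mathbf{u}\cdot\mathbf{b},$$ $$\partial_t e+\nabla\cdot\Big[\mathbf{u}\big(e+p_\perp+\tfrac{|\mathbf{B}|^2}{2}\big)+\mathbf{u}\cdot\big((p_\parallel-p_\perp)\mathbf{b}\mathbf{b}-\mathbf{B}\mathbf{B}\big)\Big]=0,$$ $$\partial_t\mathbf{B}+\nabla\times[-(\mathbf{u}\times\mathbf{B})]=0,$$ with $\nabla\cdot\mathbf{B}=0$ (that is, $\partial_xB_x=0$), taking values in the admissible set $\Omega$ with $\mathbf{B}\neq0$. Then $$\partial_t\mathcal{E}+\partial_x\mathcal{Q}_x=0,$$ where $\mathcal{E}=-\rho s$, $\mathcal{Q}_x=-\rho u_x s$ and $s=\ln\!\big(p_\parallel p_\perp^2/\rho^5\big)$.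
   Context: Here $\rho$ is the density, $\mathbf{u}=(u_x,u_y,u_z)^\top$ the velocity, $\mathbf{B}=(B_x,B_y,B_z)^\top$ the magnetic field, $\mathbf{b}=(b_x,b_y,b_z)^\top=\mathbf{B}/|\mathbf{B}|$, and $p_\parallel,p_\perp$ are the parallel and perpendicular pressure components. The total energy satisfies the equation of state $e=\frac{\rho|\mathbf{u}|^2}{2}+\frac{|\mathbf{B}|^2}{2}+\frac{3p}{2}$ with $p=\frac{2p_\perp+p_\parallel}{3}$, i.e. $p_\perp=e-\frac{\rho|\mathbf{u}|^2}{2}-\frac{|\mathbf{B}|^2}{2}-\frac{p_\parallel}{2}$. In the one-dimensional setting all unknowns depend only on $x$ and $t$ (all three components of the vectors are kept), and $\mathbf{b}\cdot\nabla\mathbf{u}\cdot\mathbf{b}=b_x(b_x\partial_xu_x+b_y\partial_xu_y+b_z\partial_xu_z)$. The admissible set is $\Omega=\{\mathbf{U}\in\mathbb{R}^9:\rho>0,\ p_\parallel>0,\ p_\perp>0,\ p_m\le p_\parallel\le p_M\}$ with $p_m=\frac{p_\perp^2}{6p_\perp+3|\mathbf{B}|^2}$ and $p_M=|\mathbf{B}|^2+p_\perp$. *)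

theory Defs
  imports "HOL-Analysis.Analysis"
begin

section \<open>Differential operators for fields on space-time\<close>

type_synonym 'a field = "real^3 \<Rightarrow> real \<Rightarrow> 'a"

definition dt :: "'a::real_normed_vector field \<Rightarrow> 'a field" where
  "dt F r t = vector_derivative (F r) (at t)"

definition pd :: "3 \<Rightarrow> 'a::real_normed_vector field \<Rightarrow> 'a field" where
  "pd i F r t = vector_derivative (\<lambda>h. F (r + h *\<^sub>R axis i 1) t) (at 0)"

definition divergence :: "(real^3) field \<Rightarrow> real field" where
  "divergence F r t = (\<Sum>i\<in>UNIV. pd i (\<lambda>r t. F r t $ i) r t)"

text \<open>Divergence of a matrix field, contracting the first index (all matrix fields below are
  symmetric, so the choice of index is immaterial).\<close>

definition tdivergence :: "(real^3^3) field \<Rightarrow> (real^3) field" where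
  "tdivergence T r t = (\<chi> j. \<Sum>i\<in>UNIV. pd i (\<lambda>r t. T r t $ i $ j) r t)"

definition curl :: "(real^3) field \<Rightarrow> (real^3) field" where
  "curl F r t = vector
     [pd 2 (\<lambda>r t. F r t $ 3) r t - pd 3 (\<lambda>r t. F r t $ 2) r t,
      pd 3 (\<lambda>r t. F r t $ 1) r t - pd 1 (\<lambda>r t. F r t $ 3) r t,
      pd 1 (\<lambda>r t. F r t $ 2) r t - pd 2 (\<lambda>r t. F r t $ 1) r t]"

text \<open>The entry at \<open>(i, j)\<close> is the \<open>i\<close>-th partial derivative of the \<open>j\<close>-th component, so that
  \<open>b v* grad u r t\<close> is the directional derivative of \<open>u\<close> along \<open>b\<close>.\<close>

definition grad :: "(real^3) field \<Rightarrow> (real^3^3) field" where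
  "grad F r t = (\<chi> i j. pd i (\<lambda>r t. F r t $ j) r t)"

definition outer :: "real^3 \<Rightarrow> real^3 \<Rightarrow> real^3^3" where
  "outer a b = (\<chi> i j. a $ i * b $ j)"


section \<open>State variables\<close>

text \<open>A state lists density, momentum (three components), parallel pressure, total energy and
  magnetic field (three components). Index \<open>9\<close> denotes the same element of the index type \<open>9\<close> as
  \<open>0\<close>; the nine indices \<open>1, \<dots>, 9\<close> are pairwise distinct.\<close>

type_synonym state = "real^9"

definition rho :: "state \<Rightarrow> real" where "rho U = U $ 1"
definition mom :: "state \<Rightarrow> real^3" where "mom U = vector [U $ 2, U $ 3, U $ 4]"
definition p_par :: "state \<Rightarrow> real" where "p_par U = U $ 5"
definition energy :: "state \<Rightarrow> real" where "energy U = U $ 6"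
definition mag :: "state \<Rightarrow> real^3" where "mag U = vector [U $ 7, U $ 8, U $ 9]"

definition vel :: "state \<Rightarrow> real^3" where "vel U = mom U /\<^sub>R rho U"
definition bdir :: "state \<Rightarrow> real^3" where "bdir U = mag U /\<^sub>R norm (mag U)"

text \<open>The equation of state \<open>e = \<rho>|u|\<^sup>2/2 + |B|\<^sup>2/2 + 3p/2\<close> with \<open>p = (2 p_perp + p_par)/3\<close>, solved for
  the perpendicular pressure.\<close>

definition p_perp :: "state \<Rightarrow> real" where
  "p_perp U = energy U - rho U * (norm (vel U))\<^sup>2 / 2 - (norm (mag U))\<^sup>2 / 2 - p_par U / 2"

definition p_m :: "state \<Rightarrow> real" where
  "p_m U = (p_perp U)\<^sup>2 / (6 * p_perp U + 3 * (norm (mag U))\<^sup>2)"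

definition p_M :: "state \<Rightarrow> real" where
  "p_M U = (norm (mag U))\<^sup>2 + p_perp U"

definition admissible :: "state set" where
  "admissible = {U. rho U > 0 \<and> p_par U > 0 \<and> p_perp U > 0 \<and> p_m U \<le> p_par U \<and> p_par U \<le> p_M U}"


section \<open>The CGL system\<close>

definition momentum_flux :: "state \<Rightarrow> real^3^3" where
  "momentum_flux U =
     rho U *\<^sub>R outer (vel U) (vel U) + p_perp U *\<^sub>R mat 1
     + (p_par U - p_perp U) *\<^sub>R outer (bdir U) (bdir U)
     - (outer (mag U) (mag U) - ((norm (mag U))\<^sup>2 / 2) *\<^sub>R mat 1)"

definition energy_flux :: "state \<Rightarrow> real^3" where
  "energy_flux U =
     (energy U + p_perp U + (norm (mag U))\<^sup>2 / 2) *\<^sub>R vel U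
     + vel U v* ((p_par U - p_perp U) *\<^sub>R outer (bdir U) (bdir U) - outer (mag U) (mag U))"

definition CGL_at :: "state field \<Rightarrow> real^3 \<Rightarrow> real \<Rightarrow> bool" where
  "CGL_at U r t \<longleftrightarrow>
     dt (\<lambda>r t. rho (U r t)) r t + divergence (\<lambda>r t. rho (U r t) *\<^sub>R vel (U r t)) r t = 0 \<and>
     dt (\<lambda>r t. rho (U r t) *\<^sub>R vel (U r t)) r t
       + tdivergence (\<lambda>r t. momentum_flux (U r t)) r t = 0 \<and>
     dt (\<lambda>r t. p_par (U r t)) r t + divergence (\<lambda>r t. p_par (U r t) *\<^sub>R vel (U r t)) r t
       = - 2 * p_par (U r t)
           * ((bdir (U r t) v* grad (\<lambda>r t. vel (U r t)) r t) \<bullet> bdir (U r t)) \<and>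
     dt (\<lambda>r t. energy (U r t)) r t + divergence (\<lambda>r t. energy_flux (U r t)) r t = 0 \<and>
     dt (\<lambda>r t. mag (U r t)) r t
       + curl (\<lambda>r t. - cross3 (vel (U r t)) (mag (U r t))) r t = 0"

definition solenoidal_at :: "state field \<Rightarrow> real^3 \<Rightarrow> real \<Rightarrow> bool" where
  "solenoidal_at U r t \<longleftrightarrow> divergence (\<lambda>r t. mag (U r t)) r t = 0"


section \<open>Solutions depending on the first space coordinate and time only\<close>

definition planar :: "(real \<times> real \<Rightarrow> 'a) \<Rightarrow> 'a field" where
  "planar V r t = V (r $ 1, t)"

definition C1_on :: "('a::real_normed_vector \<Rightarrow> 'b::real_normed_vector) \<Rightarrow> 'a set \<Rightarrow> bool" where
  "C1_on f S \<longleftrightarrow>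
     (\<exists>f'. (\<forall>x\<in>S. (f has_derivative blinfun_apply (f' x)) (at x)) \<and> continuous_on S f')"

definition smooth_solution_1d :: "(real \<times> real) set \<Rightarrow> (real \<times> real \<Rightarrow> state) \<Rightarrow> bool" where
  "smooth_solution_1d S V \<longleftrightarrow>
     C1_on V S \<and>
     (\<forall>r t. (r $ 1, t) \<in> S \<longrightarrow> CGL_at (planar V) r t \<and> solenoidal_at (planar V) r t)"


section \<open>Entropy pair\<close>

definition entropy_s :: "state \<Rightarrow> real" where
  "entropy_s U = ln (p_par U * (p_perp U)\<^sup>2 / rho U ^ 5)"

definition entropy_E :: "state \<Rightarrow> real" where
  "entropy_E U = - rho U * entropy_s U"

definition entropy_Qx :: "state \<Rightarrow> real" where
  "entropy_Qx U = - rho U * vel U $ 1 * entropy_s U"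

end

theory Submission
  imports Defs
begin

text \<open>Conservation of \<open>-\<rho> s\<close> is the continuity equation combined with the statement that \<open>s\<close> is
  carried along by the flow, because
  \<open>\<partial>\<^sub>t (\<rho> s) + \<partial>\<^sub>x (\<rho> u\<^sub>x s) = s (\<partial>\<^sub>t \<rho> + \<partial>\<^sub>x (\<rho> u\<^sub>x)) + \<rho> (\<partial>\<^sub>t s + u\<^sub>x \<partial>\<^sub>x s)\<close>.

  Write \<open>D = \<partial>\<^sub>t + u\<^sub>x \<partial>\<^sub>x\<close> and \<open>w\<close> for the stretching rate of the fluid along the magnetic field
  lines, the number \<open>b \<cdot> \<nabla>u \<cdot> b\<close>. The density and the parallel pressure satisfy
  \<open>D \<rho> = - \<rho> \<partial>\<^sub>x u\<^sub>x\<close> and \<open>D p_par = - p_par (\<partial>\<^sub>x u\<^sub>x + 2 w)\<close> by the system itself. The perpendicular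
  pressure has no equation of its own in the system; the substance of the proof is that
  \<open>D p_perp = p_perp (w - 2 \<partial>\<^sub>x u\<^sub>x)\<close>, see \<open>p_perp_planar\<close>. This comes from subtracting three
  balances from the energy equation: the kinetic energy balance, obtained by pairing the momentum
  equation with \<open>u\<close>, the magnetic energy balance, obtained by pairing the induction equation with
  \<open>B\<close>, and half of the equation for \<open>p_par\<close>. Then \<open>s = ln p_par + 2 ln p_perp - 5 ln \<rho>\<close> satisfies
  \<open>D s = 0\<close>, see \<open>entropy_transport\<close>.

  Everything is pointwise. At a fixed point of space-time the first-order rates of change of the
  primitive variables \<open>\<rho>, u, p_par, p_perp, B\<close> in \<open>x\<close> and in \<open>t\<close> are treated as unknown numbers,
  and each equation of the system becomes an algebraic relation between them.\<close>

section \<open>Differential operators on fields that depend on one space coordinate\<close>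

lemma pd_eqI:
  assumes "\<And>s. F s t = f (s $ 1)" and "(f has_real_derivative D) (at (r $ 1))"
  shows "pd 1 F r t = D"
proof -
  have "((\<lambda>h. f (r $ 1 + h)) has_real_derivative D) (at 0)"
    using assms(2) DERIV_shift[of f D 0 "r $ 1"] by (simp add: add.commute)
  then show ?thesis
    by (simp add: pd_def assms(1) axis_def vector_derivative_at
        has_real_derivative_iff_has_vector_derivative)
qed

lemma pd_transverse:
  assumes "\<And>s. F s t = f (s $ 1)" and "i \<noteq> 1"
  shows "pd i F r t = 0"
  using assms(2) by (simp add: pd_def assms(1) axis_def)

lemma divergence_planar:
  assumes "\<And>s. F s t = f (s $ 1)" and "((\<lambda>\<xi>. f \<xi> $ 1) has_real_derivative D) (at (r $ 1))"
  shows "divergence F r t = D"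
proof -
  have "pd 1 (\<lambda>r t. F r t $ 1) r t = D"
    using assms by (intro pd_eqI[where f = "\<lambda>\<xi>. f \<xi> $ 1"]) auto
  moreover have "pd i (\<lambda>r t. F r t $ i) r t = 0" if "i \<noteq> 1" for i
    using assms that by (intro pd_transverse[where f = "\<lambda>\<xi>. f \<xi> $ i"]) auto
  ultimately show ?thesis by (simp add: divergence_def sum_3)
qed

lemma tdivergence_planar:
  assumes "\<And>s. F s t = f (s $ 1)" and "((\<lambda>\<xi>. f \<xi> $ 1 $ j) has_real_derivative D) (at (r $ 1))"
  shows "tdivergence F r t $ j = D"
proof -
  have "pd 1 (\<lambda>r t. F r t $ 1 $ j) r t = D"
    using assms by (intro pd_eqI[where f = "\<lambda>\<xi>. f \<xi> $ 1 $ j"]) auto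
  moreover have "pd i (\<lambda>r t. F r t $ i $ j) r t = 0" if "i \<noteq> 1" for i
    using assms that by (intro pd_transverse[where f = "\<lambda>\<xi>. f \<xi> $ i $ j"]) auto
  ultimately show ?thesis by (simp add: tdivergence_def sum_3)
qed

lemma curl_planar:
  assumes "\<And>s. F s t = f (s $ 1)"
    and "\<And>j. ((\<lambda>\<xi>. f \<xi> $ j) has_real_derivative D $ j) (at (r $ 1))"
  shows "curl F r t = vector [0, - D $ 3, D $ 2]"
proof -
  have "pd 1 (\<lambda>r t. F r t $ j) r t = D $ j" for j
    using assms by (intro pd_eqI[where f = "\<lambda>\<xi>. f \<xi> $ j"]) auto
  moreover have "pd i (\<lambda>r t. F r t $ j) r t = 0" if "i \<noteq> 1" for i j
    using assms that by (intro pd_transverse[where f = "\<lambda>\<xi>. f \<xi> $ j"]) auto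
  ultimately show ?thesis by (simp add: curl_def)
qed

lemma vector_grad_planar:
  assumes "\<And>s. F s t = f (s $ 1)"
    and "\<And>j. ((\<lambda>\<xi>. f \<xi> $ j) has_real_derivative D $ j) (at (r $ 1))"
  shows "b v* grad F r t = b $ 1 *\<^sub>R D"
proof -
  have "pd 1 (\<lambda>r t. F r t $ j) r t = D $ j" for j
    using assms by (intro pd_eqI[where f = "\<lambda>\<xi>. f \<xi> $ j"]) auto
  moreover have "pd i (\<lambda>r t. F r t $ j) r t = 0" if "i \<noteq> 1" for i j
    using assms that by (intro pd_transverse[where f = "\<lambda>\<xi>. f \<xi> $ j"]) auto
  ultimately show ?thesis
    by (simp add: grad_def vec_eq_iff vector_matrix_mult_def sum_3)
qed

lemma dt_eqI: "(F r has_real_derivative D) (at t) \<Longrightarrow> dt F r t = D"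
  by (simp add: dt_def vector_derivative_at has_real_derivative_iff_has_vector_derivative)

lemma dt_nth:
  assumes "F r differentiable at t" and "((\<lambda>\<tau>. F r \<tau> $ j) has_real_derivative D) (at t)"
  shows "dt F r t $ j = D"
proof -
  have "(F r has_vector_derivative dt F r t) (at t)"
    using assms(1) by (simp add: dt_def vector_derivative_works)
  from bounded_linear.has_vector_derivative[OF bounded_linear_vec_nth this, of j]
  show ?thesis
    using assms(2) by (auto simp: has_real_derivative_iff_has_vector_derivative
        intro: vector_derivative_unique_at)
qed

section \<open>Rates of change of the primitive variables\<close>

lemma norm_sq_3: "(norm (v :: real^3))\<^sup>2 = (v $ 1)\<^sup>2 + (v $ 2)\<^sup>2 + (v $ 3)\<^sup>2"
  unfolding power2_norm_eq_inner by (simp add: inner_vec_def sum_3 power2_eq_square)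

lemma half_norm_sq_rate:
  fixes v :: "real \<Rightarrow> real^3"
  assumes "\<And>i. ((\<lambda>h. v h $ i) has_real_derivative v' $ i) (at s)"
  shows "((\<lambda>h. (norm (v h))\<^sup>2 / 2) has_real_derivative v s \<bullet> v') (at s)"
proof -
  have "((\<lambda>h. (v h $ 1)\<^sup>2 + (v h $ 2)\<^sup>2 + (v h $ 3)\<^sup>2) has_real_derivative 2 * (v s \<bullet> v')) (at s)"
    by (rule derivative_eq_intros assms refl)+ (simp add: inner_vec_def sum_3)
  from DERIV_cdivide[OF this, of 2] show ?thesis by (simp add: norm_sq_3)
qed

text \<open>The curve \<open>c\<close> is a solution restricted to a line parallel to the \<open>x\<close>- or the \<open>t\<close>-axis, so that
  one notion serves both for space and for time derivatives. The primitive variables are used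
  instead of the nine conserved components because the fluxes are polynomial in them, apart from
  the factor \<open>anisotropy\<close> introduced below.\<close>

definition has_primitive_rates ::
  "(real \<Rightarrow> state) \<Rightarrow> real \<Rightarrow> real \<Rightarrow> real^3 \<Rightarrow> real \<Rightarrow> real \<Rightarrow> real^3 \<Rightarrow> bool" where
  "has_primitive_rates c s \<rho>' u' p' q' B' \<longleftrightarrow>
     ((\<lambda>h. rho (c h)) has_real_derivative \<rho>') (at s) \<and>
     (\<forall>i. ((\<lambda>h. vel (c h) $ i) has_real_derivative u' $ i) (at s)) \<and>
     ((\<lambda>h. p_par (c h)) has_real_derivative p') (at s) \<and>
     ((\<lambda>h. p_perp (c h)) has_real_derivative q') (at s) \<and>
     (\<forall>i. ((\<lambda>h. mag (c h) $ i) has_real_derivative B' $ i) (at s))"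

lemma has_primitive_ratesD:
  assumes "has_primitive_rates c s \<rho>' u' p' q' B'"
  shows "((\<lambda>h. rho (c h)) has_real_derivative \<rho>') (at s)"
    and "((\<lambda>h. vel (c h) $ i) has_real_derivative u' $ i) (at s)"
    and "((\<lambda>h. p_par (c h)) has_real_derivative p') (at s)"
    and "((\<lambda>h. p_perp (c h)) has_real_derivative q') (at s)"
    and "((\<lambda>h. mag (c h) $ i) has_real_derivative B' $ i) (at s)"
  using assms by (auto simp: has_primitive_rates_def)

lemma bounded_linear_mom: "bounded_linear mom"
  by (intro linear_conv_bounded_linear[THEN iffD1] linearI)
    (simp_all add: mom_def vec_eq_iff forall_3)

lemma bounded_linear_mag: "bounded_linear mag"
  by (intro linear_conv_bounded_linear[THEN iffD1] linearI)
    (simp_all add: mag_def vec_eq_iff forall_3)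

lemma mag_differentiable: "c differentiable at s \<Longrightarrow> (\<lambda>h. mag (c h)) differentiable at s"
  unfolding differentiable_def
  using bounded_linear.has_derivative[OF bounded_linear_mag] by blast

lemma component_differentiable:
  fixes c :: "real \<Rightarrow> real^'n"
  shows "c differentiable at s \<Longrightarrow> (\<lambda>h. c h $ i) differentiable at s"
  unfolding differentiable_def
  using bounded_linear.has_derivative[OF bounded_linear_vec_nth] by blast

lemma vel_differentiable:
  fixes c :: "real \<Rightarrow> state"
  assumes "c differentiable at s" and "rho (c s) \<noteq> 0"
  shows "(\<lambda>h. vel (c h)) differentiable at s"
proof -
  have "(\<lambda>h. mom (c h)) differentiable at s"
    using assms(1) bounded_linear.has_derivative[OF bounded_linear_mom]
    unfolding differentiable_def by blast
  moreover have "(\<lambda>h. inverse (rho (c h))) differentiable at s"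
    using assms component_differentiable[of c s 1] by (simp add: rho_def)
  ultimately show ?thesis unfolding vel_def by (intro differentiable_scaleR)
qed

lemma primitive_rates_exist:
  assumes "c differentiable at s" and "rho (c s) \<noteq> 0"
  obtains \<rho>' u' p' q' B' where "has_primitive_rates c s \<rho>' u' p' q' B'"
proof -
  have comp: "(\<lambda>h. c h $ i) differentiable at s" for i
    using assms(1) by (rule component_differentiable)
  have vel: "(\<lambda>h. vel (c h) $ i) differentiable at s" for i
    using vel_differentiable[OF assms] by (rule component_differentiable)
  have mag: "(\<lambda>h. mag (c h) $ i) differentiable at s" for i
    using mag_differentiable[OF assms(1)] by (rule component_differentiable)
  have rho: "(\<lambda>h. rho (c h)) differentiable at s"
    and p: "(\<lambda>h. p_par (c h)) differentiable at s"
    and e: "(\<lambda>h. energy (c h)) differentiable at s"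
    using comp by (simp_all add: rho_def p_par_def energy_def)
  have q: "(\<lambda>h. p_perp (c h)) differentiable at s"
    unfolding p_perp_def norm_sq_3
    by (intro derivative_intros rho p e vel mag) auto
  show thesis
    by (rule that[of "deriv (\<lambda>h. rho (c h)) s" "\<chi> i. deriv (\<lambda>h. vel (c h) $ i) s"
          "deriv (\<lambda>h. p_par (c h)) s" "deriv (\<lambda>h. p_perp (c h)) s"
          "\<chi> i. deriv (\<lambda>h. mag (c h) $ i) s"])
      (use rho vel p q mag in \<open>auto simp: has_primitive_rates_def DERIV_deriv_iff_real_differentiable\<close>)
qed

section \<open>The fluxes in terms of primitive variables\<close>

lemma bdir_nth_mult: "bdir V $ i * bdir V $ j = mag V $ i * mag V $ j / (norm (mag V))\<^sup>2"
  by (simp add: bdir_def power2_eq_square divide_inverse)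

text \<open>With this scalar the tensors \<open>(p_par - p_perp) b b\<close> and \<open>B B\<close> of the fluxes merge into
  \<open>(anisotropy - 1) B B\<close>. The direction \<open>b\<close> and its derivative then disappear from the momentum and
  energy equations, and the derivative of the anisotropy cancels between the two.\<close>

definition anisotropy :: "state \<Rightarrow> real" where
  "anisotropy V = (p_par V - p_perp V) / (norm (mag V))\<^sup>2"

lemma momentum_flux_nth:
  "momentum_flux V $ 1 $ j = rho V * vel V $ 1 * vel V $ j
     + (p_perp V + (norm (mag V))\<^sup>2 / 2) * axis 1 1 $ j
     + (anisotropy V - 1) * mag V $ 1 * mag V $ j"
  using bdir_nth_mult[of V 1 j]
  by (auto simp: momentum_flux_def outer_def mat_def axis_def anisotropy_def algebra_simps diff_divide_distrib)

lemma energy_flux_nth: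
  "energy_flux V $ 1 = (energy V + p_perp V + (norm (mag V))\<^sup>2 / 2) * vel V $ 1
     + (anisotropy V - 1) * (vel V \<bullet> mag V) * mag V $ 1"
proof -
  have b: "(p_par V - p_perp V) * (bdir V $ i * bdir V $ j)
      = anisotropy V * (mag V $ i * mag V $ j)" for i j
    by (simp add: bdir_nth_mult anisotropy_def)
  show ?thesis
    by (simp add: energy_flux_def outer_def vector_matrix_mult_def sum_3 b inner_vec_def)
       (simp add: algebra_simps)
qed

lemma energy_eq:
  "energy V = rho V * ((norm (vel V))\<^sup>2 / 2) + (norm (mag V))\<^sup>2 / 2 + p_perp V + p_par V / 2"
  by (simp add: p_perp_def)

section \<open>The equations at a point\<close>

text \<open>The subscripted parameters are the rates of change at the point with first coordinate \<open>r $ 1\<close>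
  and time \<open>t\<close>; in them the subscript \<open>x\<close> stands for the space derivative, not for a vector
  component.\<close>

locale planar_CGL_point =
  fixes U :: "real \<times> real \<Rightarrow> state" and r :: "real^3" and t :: real
    and \<rho>\<^sub>x p\<^sub>x q\<^sub>x \<rho>\<^sub>t p\<^sub>t q\<^sub>t :: real and u\<^sub>x B\<^sub>x u\<^sub>t B\<^sub>t :: "real^3"
  assumes cgl: "CGL_at (planar U) r t" and sol: "solenoidal_at (planar U) r t"
    and x_rates: "has_primitive_rates (\<lambda>\<xi>. U (\<xi>, t)) (r $ 1) \<rho>\<^sub>x u\<^sub>x p\<^sub>x q\<^sub>x B\<^sub>x"
    and t_rates: "has_primitive_rates (\<lambda>\<tau>. U (r $ 1, \<tau>)) t \<rho>\<^sub>t u\<^sub>t p\<^sub>t q\<^sub>t B\<^sub>t"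
    and U_t: "(\<lambda>\<tau>. U (r $ 1, \<tau>)) differentiable at t"
    and rho_pos: "rho (U (r $ 1, t)) > 0"
    and mag_nz: "mag (U (r $ 1, t)) \<noteq> 0"
begin

abbreviation "\<rho> \<equiv> rho (U (r $ 1, t))"
abbreviation "u \<equiv> vel (U (r $ 1, t))"
abbreviation "p \<equiv> p_par (U (r $ 1, t))"
abbreviation "q \<equiv> p_perp (U (r $ 1, t))"
abbreviation "B \<equiv> mag (U (r $ 1, t))"

lemmas dx = has_primitive_ratesD[OF x_rates]
lemmas dtau = has_primitive_ratesD[OF t_rates]

lemma mass_planar: "\<rho>\<^sub>t + \<rho>\<^sub>x * u $ 1 + \<rho> * u\<^sub>x $ 1 = 0"
proof -
  have "dt (\<lambda>r t. rho (planar U r t)) r t = \<rho>\<^sub>t"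
    by (intro dt_eqI) (simp add: planar_def dtau)
  moreover have "divergence (\<lambda>r t. rho (planar U r t) *\<^sub>R vel (planar U r t)) r t
      = \<rho>\<^sub>x * u $ 1 + \<rho> * u\<^sub>x $ 1"
    by (rule divergence_planar[where f = "\<lambda>\<xi>. rho (U (\<xi>, t)) *\<^sub>R vel (U (\<xi>, t))"])
       (auto simp: planar_def intro!: derivative_eq_intros dx)
  ultimately show ?thesis using cgl by (simp add: CGL_at_def)
qed

lemma solenoidal_planar: "B\<^sub>x $ 1 = 0"
proof -
  have "divergence (\<lambda>r t. mag (planar U r t)) r t = B\<^sub>x $ 1"
    by (rule divergence_planar[where f = "\<lambda>\<xi>. mag (U (\<xi>, t))"]) (auto simp: planar_def dx)
  then show ?thesis using sol by (simp add: solenoidal_at_def)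
qed

text \<open>The advective form differs from the curl form by the term \<open>B\<^sub>x $ 1 *\<^sub>R u\<close>, which vanishes
  because \<open>B\<close> is solenoidal.\<close>

lemma induction_planar:
  "B\<^sub>t = B $ 1 *\<^sub>R u\<^sub>x - u\<^sub>x $ 1 *\<^sub>R B - u $ 1 *\<^sub>R B\<^sub>x"
proof -
  let ?D = "- (cross3 u\<^sub>x B + cross3 u B\<^sub>x)"
  have "((\<lambda>\<xi>. (- cross3 (vel (U (\<xi>, t))) (mag (U (\<xi>, t)))) $ j) has_real_derivative ?D $ j)
      (at (r $ 1))" for j
  proof -
    consider "j = 1" | "j = 2" | "j = 3" using exhaust_3[of j] by blast
    then show ?thesis
      by cases (hypsubst, simp only: cross3_def vector_3 vector_uminus_component
          vector_add_component, (rule derivative_eq_intros dx refl)+, simp add: algebra_simps)+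
  qed
  then have "curl (\<lambda>r t. - cross3 (vel (planar U r t)) (mag (planar U r t))) r t
      = vector [0, - ?D $ 3, ?D $ 2]"
    by (intro curl_planar[where f = "\<lambda>\<xi>. - cross3 (vel (U (\<xi>, t))) (mag (U (\<xi>, t)))"])
       (auto simp: planar_def)
  moreover have "dt (\<lambda>r t. mag (planar U r t)) r t $ j = B\<^sub>t $ j" for j
    using mag_differentiable[OF U_t] by (intro dt_nth) (simp_all add: planar_def dtau)
  then have "dt (\<lambda>r t. mag (planar U r t)) r t = B\<^sub>t" by (simp add: vec_eq_iff)
  ultimately have "B\<^sub>t + vector [0, - ?D $ 3, ?D $ 2] = 0"
    using cgl by (simp add: CGL_at_def)
  then show ?thesis
    by (simp add: vec_eq_iff forall_3 cross3_def solenoidal_planar algebra_simps)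
qed

lemma p_par_planar:
  "p\<^sub>t + p\<^sub>x * u $ 1 + p * u\<^sub>x $ 1 = - 2 * p * (B $ 1 * (u\<^sub>x \<bullet> B) / (norm B)\<^sup>2)"
proof -
  have "dt (\<lambda>r t. p_par (planar U r t)) r t = p\<^sub>t"
    by (intro dt_eqI) (simp add: planar_def dtau)
  moreover have "divergence (\<lambda>r t. p_par (planar U r t) *\<^sub>R vel (planar U r t)) r t
      = p\<^sub>x * u $ 1 + p * u\<^sub>x $ 1"
    by (rule divergence_planar[where f = "\<lambda>\<xi>. p_par (U (\<xi>, t)) *\<^sub>R vel (U (\<xi>, t))"])
       (auto simp: planar_def intro!: derivative_eq_intros dx)
  moreover have "bdir (U (r $ 1, t)) v* grad (\<lambda>r t. vel (planar U r t)) r t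
      = bdir (U (r $ 1, t)) $ 1 *\<^sub>R u\<^sub>x"
    by (rule vector_grad_planar[where f = "\<lambda>\<xi>. vel (U (\<xi>, t))"]) (auto simp: planar_def dx)
  moreover have "(bdir (U (r $ 1, t)) $ 1 *\<^sub>R u\<^sub>x) \<bullet> bdir (U (r $ 1, t))
      = B $ 1 * (u\<^sub>x \<bullet> B) / (norm B)\<^sup>2"
    by (simp add: bdir_def power2_eq_square divide_inverse)
  ultimately show ?thesis using cgl by (simp add: CGL_at_def planar_def)
qed

lemma anisotropy_differentiable:
  obtains a\<^sub>x where "((\<lambda>\<xi>. anisotropy (U (\<xi>, t))) has_real_derivative a\<^sub>x) (at (r $ 1))"
proof -
  have n: "(B $ 1)\<^sup>2 + (B $ 2)\<^sup>2 + (B $ 3)\<^sup>2 \<noteq> 0"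
    using mag_nz by (simp flip: norm_sq_3)
  show thesis
    by (rule that, unfold anisotropy_def norm_sq_3, (rule derivative_eq_intros dx refl n)+)
qed

text \<open>Subtracting \<open>u\<close> times the continuity equation turns the conservative form of the momentum
  equation into an equation for the acceleration.\<close>

lemma momentum_planar:
  assumes "((\<lambda>\<xi>. anisotropy (U (\<xi>, t))) has_real_derivative a\<^sub>x) (at (r $ 1))"
  shows "\<rho> * (u\<^sub>t $ j + u $ 1 * u\<^sub>x $ j) + (q\<^sub>x + B \<bullet> B\<^sub>x) * axis 1 1 $ j
    + B $ 1 * (a\<^sub>x * B $ j + (anisotropy (U (r $ 1, t)) - 1) * B\<^sub>x $ j) = 0"
proof -
  let ?a = "anisotropy (U (r $ 1, t))"
  have "(\<lambda>\<tau>. rho (U (r $ 1, \<tau>)) *\<^sub>R vel (U (r $ 1, \<tau>))) differentiable at t"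
    using rho_pos dtau(1) vel_differentiable[OF U_t] unfolding real_differentiable_def
    by (intro differentiable_scaleR) (auto simp: real_differentiable_def)
  then have "dt (\<lambda>r t. rho (planar U r t) *\<^sub>R vel (planar U r t)) r t $ j = \<rho>\<^sub>t * u $ j + \<rho> * u\<^sub>t $ j"
    by (intro dt_nth) (auto simp: planar_def intro!: derivative_eq_intros dtau)
  moreover have "tdivergence (\<lambda>r t. momentum_flux (planar U r t)) r t $ j
    = \<rho>\<^sub>x * u $ 1 * u $ j + \<rho> * u\<^sub>x $ 1 * u $ j + \<rho> * u $ 1 * u\<^sub>x $ j
      + (q\<^sub>x + B \<bullet> B\<^sub>x) * axis 1 1 $ j
      + (a\<^sub>x * B $ 1 * B $ j + (?a - 1) * B $ 1 * B\<^sub>x $ j)"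
    by (rule tdivergence_planar[where f = "\<lambda>\<xi>. momentum_flux (U (\<xi>, t))"], simp add: planar_def)
       (unfold momentum_flux_nth,
        (rule dx half_norm_sq_rate[OF dx(5)] assms derivative_eq_intros refl)+,
        simp add: solenoidal_planar algebra_simps)
  moreover have "dt (\<lambda>r t. rho (planar U r t) *\<^sub>R vel (planar U r t)) r t
      + tdivergence (\<lambda>r t. momentum_flux (planar U r t)) r t = 0"
    using cgl by (simp only: CGL_at_def)
  from arg_cong[OF this, of "\<lambda>v. v $ j"]
  have "dt (\<lambda>r t. rho (planar U r t) *\<^sub>R vel (planar U r t)) r t $ j
      + tdivergence (\<lambda>r t. momentum_flux (planar U r t)) r t $ j = 0" by simp
  ultimately have "\<rho>\<^sub>t * u $ j + \<rho> * u\<^sub>t $ j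
      + (\<rho>\<^sub>x * u $ 1 * u $ j + \<rho> * u\<^sub>x $ 1 * u $ j + \<rho> * u $ 1 * u\<^sub>x $ j
      + (q\<^sub>x + B \<bullet> B\<^sub>x) * axis 1 1 $ j
      + (a\<^sub>x * B $ 1 * B $ j + (?a - 1) * B $ 1 * B\<^sub>x $ j)) = 0"
    by (simp only:)
  moreover have "(\<rho>\<^sub>t + \<rho>\<^sub>x * u $ 1 + \<rho> * u\<^sub>x $ 1) * u $ j = 0" by (simp add: mass_planar)
  ultimately show ?thesis by (simp only: distrib_left distrib_right) (simp add: algebra_simps)
qed

lemma energy_planar:
  assumes "((\<lambda>\<xi>. anisotropy (U (\<xi>, t))) has_real_derivative a\<^sub>x) (at (r $ 1))"
  shows "\<rho>\<^sub>t * (u \<bullet> u) / 2 + \<rho> * (u \<bullet> u\<^sub>t) + B \<bullet> B\<^sub>t + q\<^sub>t + p\<^sub>t / 2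
    + ((\<rho>\<^sub>x * (u \<bullet> u) / 2 + \<rho> * (u \<bullet> u\<^sub>x) + 2 * (B \<bullet> B\<^sub>x) + 2 * q\<^sub>x + p\<^sub>x / 2) * u $ 1
      + (\<rho> * (u \<bullet> u) / 2 + B \<bullet> B + 2 * q + p / 2) * u\<^sub>x $ 1)
    + B $ 1 * (a\<^sub>x * (u \<bullet> B) + (anisotropy (U (r $ 1, t)) - 1) * (u\<^sub>x \<bullet> B + u \<bullet> B\<^sub>x)) = 0"
proof -
  have "dt (\<lambda>r t. energy (planar U r t)) r t
      = \<rho>\<^sub>t * (u \<bullet> u) / 2 + \<rho> * (u \<bullet> u\<^sub>t) + B \<bullet> B\<^sub>t + q\<^sub>t + p\<^sub>t / 2"
    by (rule dt_eqI, unfold planar_def energy_eq,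
        (rule dtau half_norm_sq_rate[OF dtau(2)] half_norm_sq_rate[OF dtau(5)]
          DERIV_cdivide[OF dtau(3)] derivative_eq_intros refl)+,
        simp_all add: power2_norm_eq_inner)
  moreover have "divergence (\<lambda>r t. energy_flux (planar U r t)) r t
      = ((\<rho>\<^sub>x * (u \<bullet> u) / 2 + \<rho> * (u \<bullet> u\<^sub>x) + 2 * (B \<bullet> B\<^sub>x) + 2 * q\<^sub>x + p\<^sub>x / 2) * u $ 1
      + (\<rho> * (u \<bullet> u) / 2 + B \<bullet> B + 2 * q + p / 2) * u\<^sub>x $ 1)
    + B $ 1 * (a\<^sub>x * (u \<bullet> B) + (anisotropy (U (r $ 1, t)) - 1) * (u\<^sub>x \<bullet> B + u \<bullet> B\<^sub>x))"
  proof (rule divergence_planar[where f = "\<lambda>\<xi>. energy_flux (U (\<xi>, t))"])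
    have uB: "((\<lambda>\<xi>. vel (U (\<xi>, t)) \<bullet> mag (U (\<xi>, t))) has_real_derivative
        u\<^sub>x \<bullet> B + u \<bullet> B\<^sub>x) (at (r $ 1))"
      unfolding inner_vec_def sum_3 inner_real_def
      by (rule dx derivative_eq_intros refl)+ (simp add: algebra_simps)
    show "((\<lambda>\<xi>. energy_flux (U (\<xi>, t)) $ 1) has_real_derivative
      ((\<rho>\<^sub>x * (u \<bullet> u) / 2 + \<rho> * (u \<bullet> u\<^sub>x) + 2 * (B \<bullet> B\<^sub>x) + 2 * q\<^sub>x + p\<^sub>x / 2) * u $ 1
      + (\<rho> * (u \<bullet> u) / 2 + B \<bullet> B + 2 * q + p / 2) * u\<^sub>x $ 1)
      + B $ 1 * (a\<^sub>x * (u \<bullet> B) + (anisotropy (U (r $ 1, t)) - 1) * (u\<^sub>x \<bullet> B + u \<bullet> B\<^sub>x)))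
      (at (r $ 1))"
      unfolding energy_flux_nth energy_eq
      by (rule uB dx half_norm_sq_rate[OF dx(2)] half_norm_sq_rate[OF dx(5)]
          DERIV_cdivide[OF dx(3)] assms derivative_eq_intros refl)+
        (simp_all add: solenoidal_planar power2_norm_eq_inner algebra_simps)
  qed (simp add: planar_def)
  ultimately show ?thesis using cgl by (simp add: CGL_at_def)
qed

text \<open>In the energy equation, the kinetic and the magnetic balances remove all terms that involve
  the magnetic field except the tension terms \<open>(anisotropy - 1) B $ 1 (u\<^sub>x \<bullet> B)\<close> and
  \<open>B $ 1 (u\<^sub>x \<bullet> B)\<close>. Their sum is \<open>(p_par - p_perp) w\<close>, the work done by the anisotropic stress when the field lines are
  stretched. The part \<open>p_par w\<close> is accounted for by half of the equation for \<open>p_par\<close>, and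
  \<open>p_perp w\<close> remains.\<close>

lemma p_perp_planar:
  "q\<^sub>t + u $ 1 * q\<^sub>x = q * (B $ 1 * (u\<^sub>x \<bullet> B) / (norm B)\<^sup>2) - 2 * q * u\<^sub>x $ 1"
proof -
  obtain a\<^sub>x where ax: "((\<lambda>\<xi>. anisotropy (U (\<xi>, t))) has_real_derivative a\<^sub>x) (at (r $ 1))"
    by (rule anisotropy_differentiable)
  define a where "a = anisotropy (U (r $ 1, t))"
  define w where "w = B $ 1 * (u\<^sub>x \<bullet> B) / (norm B)\<^sup>2"
  have aw: "a * (B $ 1 * (u\<^sub>x \<bullet> B)) = (p - q) * w"
    by (simp add: a_def w_def anisotropy_def)
  \<comment> \<open>kinetic energy: the momentum equation paired with \<open>u\<close>\<close>
  have kin: "\<rho> * (u \<bullet> u\<^sub>t + u $ 1 * (u \<bullet> u\<^sub>x)) + u $ 1 * (q\<^sub>x + B \<bullet> B\<^sub>x)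
      + B $ 1 * (a\<^sub>x * (u \<bullet> B) + (a - 1) * (u \<bullet> B\<^sub>x)) = 0"
  proof -
    have "(\<Sum>j\<in>UNIV. u $ j * (\<rho> * (u\<^sub>t $ j + u $ 1 * u\<^sub>x $ j)
      + (q\<^sub>x + B \<bullet> B\<^sub>x) * axis 1 1 $ j + B $ 1 * (a\<^sub>x * B $ j + (a - 1) * B\<^sub>x $ j))) = 0"
      using momentum_planar[OF ax] by (simp add: a_def)
    then show ?thesis
      by (simp add: sum_3 axis_def inner_vec_def[of u] algebra_simps)
  qed
  \<comment> \<open>magnetic energy: the induction equation paired with \<open>B\<close>\<close>
  have magn: "B \<bullet> B\<^sub>t = B $ 1 * (u\<^sub>x \<bullet> B) - u\<^sub>x $ 1 * (B \<bullet> B) - u $ 1 * (B \<bullet> B\<^sub>x)"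
    by (simp add: induction_planar inner_simps inner_commute)
  \<comment> \<open>\<open>kin\<close> has no \<open>\<rho>\<^sub>t\<close>; the derivative of \<open>\<rho>\<close> inside the kinetic energy is cancelled separately\<close>
  have mass: "(\<rho>\<^sub>t + \<rho>\<^sub>x * u $ 1 + \<rho> * u\<^sub>x $ 1) * (u \<bullet> u) / 2 = 0" by (simp add: mass_planar)
  have "q\<^sub>t + u $ 1 * q\<^sub>x + (p\<^sub>t + p\<^sub>x * u $ 1 + p * u\<^sub>x $ 1) / 2 + 2 * q * u\<^sub>x $ 1
      + a * (B $ 1 * (u\<^sub>x \<bullet> B)) = 0"
    using energy_planar[OF ax, folded a_def] kin mass
    unfolding magn by (simp add: algebra_simps add_divide_distrib)
  then show ?thesis
    unfolding aw using p_par_planar[folded w_def] by (simp add: w_def[symmetric] algebra_simps)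
qed

text \<open>In logarithmic form the equations for \<open>p_par\<close>, \<open>p_perp\<close> and \<open>\<rho>\<close> give a rate of change of \<open>s\<close>
  along the flow equal to the combination \<open>1, 2, -5\<close> of their right-hand sides: the stretching along the
  field lines enters with weight \<open>-2 + 2\<close> and the compression with weight \<open>-1 - 4 + 5\<close>.\<close>

lemma entropy_transport:
  assumes "p > 0" and "q > 0"
  shows "p\<^sub>t / p + 2 * q\<^sub>t / q - 5 * \<rho>\<^sub>t / \<rho>
    + u $ 1 * (p\<^sub>x / p + 2 * q\<^sub>x / q - 5 * \<rho>\<^sub>x / \<rho>) = 0"
proof -
  define w where "w = B $ 1 * (u\<^sub>x \<bullet> B) / (norm B)\<^sup>2"
  have "p\<^sub>t / p + 2 * q\<^sub>t / q - 5 * \<rho>\<^sub>t / \<rho> + u $ 1 * (p\<^sub>x / p + 2 * q\<^sub>x / q - 5 * \<rho>\<^sub>x / \<rho>)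
      = (p\<^sub>t + u $ 1 * p\<^sub>x) / p + 2 * (q\<^sub>t + u $ 1 * q\<^sub>x) / q - 5 * (\<rho>\<^sub>t + u $ 1 * \<rho>\<^sub>x) / \<rho>"
    by (simp add: add_divide_distrib diff_divide_distrib algebra_simps)
  also have "p\<^sub>t + u $ 1 * p\<^sub>x = p * (- 2 * w - u\<^sub>x $ 1)"
    using p_par_planar by (simp add: w_def algebra_simps)
  also have "q\<^sub>t + u $ 1 * q\<^sub>x = q * (w - 2 * u\<^sub>x $ 1)"
    using p_perp_planar by (simp add: w_def algebra_simps)
  also have "\<rho>\<^sub>t + u $ 1 * \<rho>\<^sub>x = \<rho> * (- u\<^sub>x $ 1)"
    using mass_planar by (simp add: algebra_simps)
  finally show ?thesis using assms rho_pos by simp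
qed

end

section \<open>The entropy equation\<close>

lemma entropy_s_rate:
  assumes "has_primitive_rates c s \<rho>' u' p' q' B'" and "c s \<in> admissible"
  shows "((\<lambda>h. entropy_s (c h)) has_real_derivative
    p' / p_par (c s) + 2 * q' / p_perp (c s) - 5 * \<rho>' / rho (c s)) (at s)"
proof -
  note rates = has_primitive_ratesD[OF assms(1)]
  have pos: "rho (c s) > 0" "p_par (c s) > 0" "p_perp (c s) > 0"
    using assms(2) by (auto simp: admissible_def)
  \<comment> \<open>\<open>?L\<close> is the logarithmic derivative of the argument \<open>?g\<close> of the logarithm\<close>
  let ?g = "\<lambda>V. p_par V * (p_perp V)\<^sup>2 / rho V ^ 5"
  let ?L = "p' / p_par (c s) + 2 * q' / p_perp (c s) - 5 * \<rho>' / rho (c s)"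
  have nz: "rho (c s) ^ 5 \<noteq> 0" using pos by simp
  have "((\<lambda>h. ?g (c h)) has_real_derivative ?g (c s) * ?L) (at s)"
    by (rule rates nz derivative_eq_intros refl)+
      (use pos in \<open>simp add: field_simps eval_nat_numeral\<close>)
  moreover have "?g (c s) > 0" using pos by simp
  ultimately have "((\<lambda>h. ln (?g (c h))) has_real_derivative 1 / ?g (c s) * (?g (c s) * ?L)) (at s)"
    by (intro DERIV_chain2[of ln, OF DERIV_ln_divide])
  moreover have "1 / ?g (c s) * (?g (c s) * ?L) = ?L"
    using pos by simp
  ultimately show ?thesis unfolding entropy_s_def by (simp only:)
qed

lemma entropy_E_rate:
  assumes "has_primitive_rates c s \<rho>' u' p' q' B'"
    and "((\<lambda>h. entropy_s (c h)) has_real_derivative s') (at s)"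
  shows "((\<lambda>h. entropy_E (c h)) has_real_derivative
    - (\<rho>' * entropy_s (c s) + rho (c s) * s')) (at s)"
  unfolding entropy_E_def
  by (rule has_primitive_ratesD[OF assms(1)] assms(2) derivative_eq_intros refl)+
    (simp add: algebra_simps)

lemma entropy_Qx_rate:
  assumes "has_primitive_rates c s \<rho>' u' p' q' B'"
    and "((\<lambda>h. entropy_s (c h)) has_real_derivative s') (at s)"
  shows "((\<lambda>h. entropy_Qx (c h)) has_real_derivative
    - ((\<rho>' * vel (c s) $ 1 + rho (c s) * u' $ 1) * entropy_s (c s)
       + rho (c s) * vel (c s) $ 1 * s')) (at s)"
  unfolding entropy_Qx_def
  by (rule has_primitive_ratesD[OF assms(1)] assms(2) derivative_eq_intros refl)+
    (simp add: algebra_simps)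

theorem lemma1:
  fixes S :: "(real \<times> real) set" and U :: "real \<times> real \<Rightarrow> state"
  assumes "open S"
    and "smooth_solution_1d S U"
    and "\<And>x t. (x, t) \<in> S \<Longrightarrow> U (x, t) \<in> admissible"
    and "\<And>x t. (x, t) \<in> S \<Longrightarrow> mag (U (x, t)) \<noteq> 0"
  shows "\<forall>(x, t)\<in>S.
           (\<lambda>\<tau>. entropy_E (U (x, \<tau>))) differentiable at t \<and>
           (\<lambda>\<xi>. entropy_Qx (U (\<xi>, t))) differentiable at x \<and>
           deriv (\<lambda>\<tau>. entropy_E (U (x, \<tau>))) t + deriv (\<lambda>\<xi>. entropy_Qx (U (\<xi>, t))) x = 0"
proof (clarify)
  fix x t assume xt: "(x, t) \<in> S"
  define r :: "real^3" where "r = axis 1 x"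
  have r1: "r $ 1 = x" by (simp add: r_def axis_def)
  let ?X = "\<lambda>\<xi>. U (\<xi>, t)" and ?T = "\<lambda>\<tau>. U (x, \<tau>)"
  have adm: "U (x, t) \<in> admissible" using assms(3) xt by blast
  then have pos: "rho (U (x, t)) > 0" "p_par (U (x, t)) > 0" "p_perp (U (x, t)) > 0"
    by (auto simp: admissible_def)
  have "U differentiable at (x, t)"
    using assms(2) xt unfolding smooth_solution_1d_def C1_on_def differentiable_def by blast
  then have X: "?X differentiable at x" and T: "?T differentiable at t"
    by (auto intro!: differentiable_compose[of U] derivative_intros)
  have rho_nz: "rho (U (x, t)) \<noteq> 0" using pos(1) by simp
  obtain \<rho>\<^sub>x u\<^sub>x p\<^sub>x q\<^sub>x B\<^sub>x where X_rates: "has_primitive_rates ?X x \<rho>\<^sub>x u\<^sub>x p\<^sub>x q\<^sub>x B\<^sub>x"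
    by (rule primitive_rates_exist[OF X rho_nz])
  obtain \<rho>\<^sub>t u\<^sub>t p\<^sub>t q\<^sub>t B\<^sub>t where T_rates: "has_primitive_rates ?T t \<rho>\<^sub>t u\<^sub>t p\<^sub>t q\<^sub>t B\<^sub>t"
    by (rule primitive_rates_exist[OF T rho_nz])
  interpret planar_CGL_point U r t \<rho>\<^sub>x p\<^sub>x q\<^sub>x \<rho>\<^sub>t p\<^sub>t q\<^sub>t u\<^sub>x B\<^sub>x u\<^sub>t B\<^sub>t
    using assms(2) assms(4)[OF xt] xt X_rates T_rates T pos r1
    by unfold_locales (auto simp: smooth_solution_1d_def)
  define s\<^sub>x where "s\<^sub>x = p\<^sub>x / p + 2 * q\<^sub>x / q - 5 * \<rho>\<^sub>x / \<rho>"
  define s\<^sub>t where "s\<^sub>t = p\<^sub>t / p + 2 * q\<^sub>t / q - 5 * \<rho>\<^sub>t / \<rho>"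
  have s_x: "((\<lambda>\<xi>. entropy_s (?X \<xi>)) has_real_derivative s\<^sub>x) (at x)"
    and s_t: "((\<lambda>\<tau>. entropy_s (?T \<tau>)) has_real_derivative s\<^sub>t) (at t)"
    using entropy_s_rate[OF X_rates] entropy_s_rate[OF T_rates] adm
    by (simp_all add: s\<^sub>x_def s\<^sub>t_def r1)
  have transport: "s\<^sub>t + u $ 1 * s\<^sub>x = 0"
    using entropy_transport pos by (simp add: s\<^sub>x_def s\<^sub>t_def r1)
  note E = entropy_E_rate[OF T_rates s_t] and Q = entropy_Qx_rate[OF X_rates s_x]
  have "deriv (\<lambda>\<tau>. entropy_E (?T \<tau>)) t + deriv (\<lambda>\<xi>. entropy_Qx (?X \<xi>)) x
      = - (\<rho>\<^sub>t + \<rho>\<^sub>x * u $ 1 + \<rho> * u\<^sub>x $ 1) * entropy_s (U (x, t)) - \<rho> * (s\<^sub>t + u $ 1 * s\<^sub>x)"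
    unfolding DERIV_imp_deriv[OF E] DERIV_imp_deriv[OF Q] by (simp add: r1 algebra_simps)
  also have "\<dots> = 0" by (simp add: mass_planar transport)
  finally show "(\<lambda>\<tau>. entropy_E (?T \<tau>)) differentiable at t \<and>
      (\<lambda>\<xi>. entropy_Qx (?X \<xi>)) differentiable at x \<and>
      deriv (\<lambda>\<tau>. entropy_E (?T \<tau>)) t + deriv (\<lambda>\<xi>. entropy_Qx (?X \<xi>)) x = 0"
    using E Q by (auto simp: real_differentiable_def)
qed

end
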